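(* For any $n\ge 0$, there exists a $1$-Gray code $\mathbb{Z}_n$ for $\mathcal{Z}_n$ whose first word is $0(001)^\star$ and whose last word is $(001)^\star$.
   Context: A binary word is $1$-decreasing if for every maximal run of $0$s, of length $a>0$, together with the (possibly empty) maximal run of $1$s immediately following it, of length $b$, one has $a>b$. For $n\ge1$, $\mathcal{Z}_n$ is the set of $1$-decreasing binary words of length $n$ that start with $0$; $\mathcal{Z}_0=\{\epsilon\}$ (the empty word). A $1$-Gray code for a set $\mathcal{A}$ of words of equal length is an ordered list of all elements of $\mathcal{A}$, each exactly once, such that any two consecutive words differ in at most one position (Hamming distance at most $1$). In a word of a prescribed length $n$ written as $u(001)^\star$, the symbol $(001)^\star$ denotes the prefix of $001001001\cdots$ of the length needed to make the whole word have length $n$ (e.g. for $n=7$, $(001)^\star=0010010$). *)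

theory Defs
  imports Main
begin

definition binary_word :: "nat list \<Rightarrow> bool" where
  "binary_word w \<longleftrightarrow> set w \<subseteq> {0, 1}"

text \<open>1-decreasing: every maximal run of 0s, positions i..<j (j > i), followed by the
  maximal (possibly empty) run of 1s at positions j..<k, satisfies (j - i) > (k - j).\<close>

definition one_decreasing :: "nat list \<Rightarrow> bool" where
  "one_decreasing w \<longleftrightarrow>
     (\<forall>i j k. i < j \<and> j \<le> k \<and> k \<le> length w
        \<and> (\<forall>p. i \<le> p \<and> p < j \<longrightarrow> w ! p = 0)
        \<and> (\<forall>p. j \<le> p \<and> p < k \<longrightarrow> w ! p = 1)
        \<and> (i = 0 \<or> w ! (i - 1) \<noteq> 0)
        \<and> (j = length w \<or> w ! j \<noteq> 0)
        \<and> (k = length w \<or> w ! k \<noteq> 1)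
        \<longrightarrow> k - j < j - i)"

definition Zset :: "nat \<Rightarrow> nat list set" where
  "Zset n = {w. length w = n \<and> binary_word w \<and> one_decreasing w \<and> (n \<ge> 1 \<longrightarrow> hd w = 0)}"

definition hamming :: "nat list \<Rightarrow> nat list \<Rightarrow> nat" where
  "hamming u v = card {p. p < length u \<and> p < length v \<and> u ! p \<noteq> v ! p}"

definition gray_code1 :: "nat list set \<Rightarrow> nat list list \<Rightarrow> bool" where
  "gray_code1 A L \<longleftrightarrow> distinct L \<and> set L = A \<and>
     (\<forall>i. i + 1 < length L \<longrightarrow> hamming (L ! i) (L ! (i + 1)) \<le> 1)"

definition star001 :: "nat \<Rightarrow> nat list" where
  "star001 m = map (\<lambda>i. if i mod 3 = 2 then 1 else 0) [0..<m]"

end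

(* Write the words other than 0^n as 0^a 1^b w with a > b > 0 and w in Z_(n-a-b), and group them by
   their level s = a + b. For fixed (a, b) these words form a copy of Z_(n-s), to be traversed
   between its two ends by induction. Within a level, changing the last 0 of 0^a to 1 moves from
   (a, b) to (a - 1, b + 1) without affecting w, so a level is a grid whose rows are traversed
   alternately in both directions. The end 0^a 1^b 0(001)* of a row is adjacent to the start
   0^a 1^(b+1) (001)* of a row of the next level, and 0^(s-1) 1 (001)* is adjacent to
   0^(s+2) 1 (001)*.

   For t = 4m, the levels from t on and 0^n are traversed from 0^(t-1) 1 (001)* to 0^t (001)*:
   go through levels t and t + 1, jump to level t + 4 and cover the levels from there on by
   induction, then return through levels t + 2 and t + 3 (with shortcuts for
   n < t + 6, where the last levels have rows of one word). Taking t = 4 leaves only level 3, the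
   copy 001 Z_(n-3), which is traversed at the end. *)

theory Submission
  imports Defs
begin

section \<open>Gray paths with prescribed ends: reversal, concatenation, images and snakes\<close>

text \<open>The equality case is included: \<open>x = y\<close> is permitted.\<close>

definition adj :: "nat list \<Rightarrow> nat list \<Rightarrow> bool" where
  "adj u v \<longleftrightarrow> (\<exists>p x y q. u = p @ x # q \<and> v = p @ y # q)"

lemma adj_sym: "adj u v \<Longrightarrow> adj v u"
  unfolding adj_def by blast

lemma adj_append: "adj u v \<Longrightarrow> adj (p @ u) (p @ v)"
  unfolding adj_def by (metis append_assoc)

lemma hamming_adj: "adj u v \<Longrightarrow> hamming u v \<le> 1"
proof -
  assume "adj u v"
  then obtain p x y q where "u = p @ x # q" "v = p @ y # q"
    unfolding adj_def by blast
  then have "{i. i < length u \<and> i < length v \<and> u ! i \<noteq> v ! i} \<subseteq> {length p}"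
    by (auto simp: nth_append nth_Cons' split: if_splits)
  then have "card {i. i < length u \<and> i < length v \<and> u ! i \<noteq> v ! i} \<le> card {length p}"
    by (intro card_mono) auto
  then show ?thesis
    unfolding hamming_def by simp
qed

definition gray_path :: "nat list set \<Rightarrow> nat list \<Rightarrow> nat list \<Rightarrow> bool" where
  "gray_path S x y \<longleftrightarrow> (\<exists>L. distinct L \<and> set L = S \<and> L \<noteq> [] \<and> hd L = x \<and> last L = y \<and> successively adj L)"

lemma gray_path_singleton: "gray_path {x} x x"
  unfolding gray_path_def by (rule exI[of _ "[x]"]) simp

lemma gray_path_rev: "gray_path S x y \<Longrightarrow> gray_path S y x"
proof -
  assume "gray_path S x y"
  then obtain L where L: "distinct L" "set L = S" "L \<noteq> []" "hd L = x" "last L = y" "successively adj L"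
    unfolding gray_path_def by blast
  have "successively adj (rev L)"
    unfolding successively_rev
    using L(6) by (rule successively_mono) (auto intro: adj_sym)
  with L show ?thesis
    unfolding gray_path_def by (intro exI[of _ "rev L"]) (auto simp: hd_rev last_rev)
qed

lemma gray_path_join:
  assumes "gray_path S x y" "gray_path T z w" "adj y z" "S \<inter> T = {}"
  shows "gray_path (S \<union> T) x w"
proof -
  from assms(1) obtain L where L: "distinct L" "set L = S" "L \<noteq> []" "hd L = x" "last L = y" "successively adj L"
    unfolding gray_path_def by blast
  from assms(2) obtain M where M: "distinct M" "set M = T" "M \<noteq> []" "hd M = z" "last M = w" "successively adj M"
    unfolding gray_path_def by blast
  show ?thesis
    unfolding gray_path_def using L M assms(3,4)
    by (intro exI[of _ "L @ M"]) (auto simp: successively_append_iff)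
qed

lemma gray_path_image:
  assumes "gray_path S x y" "inj f" "\<And>u v. adj u v \<Longrightarrow> adj (f u) (f v)"
  shows "gray_path (f ` S) (f x) (f y)"
proof -
  from assms(1) obtain L where L: "distinct L" "set L = S" "L \<noteq> []" "hd L = x" "last L = y" "successively adj L"
    unfolding gray_path_def by blast
  have "successively adj (map f L)"
    unfolding successively_map
    using L(6) by (rule successively_mono) (auto intro: assms(3))
  with L show ?thesis
    unfolding gray_path_def
    by (intro exI[of _ "map f L"])
       (auto simp: hd_map last_map distinct_map intro: inj_on_subset[OF assms(2)])
qed

lemma gray_path_mem: "gray_path S x y \<Longrightarrow> x \<in> S \<and> y \<in> S"
  unfolding gray_path_def by auto

text \<open>Serves to read the first word of a row separately from the others. Distinct ends
  guarantee that something is left after the removal.\<close>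

lemma gray_path_remove_first:
  assumes "gray_path S x y" "x \<noteq> y"
  obtains x' where "adj x x'" "gray_path (S - {x}) x' y"
proof -
  from assms(1) obtain L where L: "distinct L" "set L = S" "L \<noteq> []" "hd L = x" "last L = y" "successively adj L"
    unfolding gray_path_def by blast
  then obtain M where M: "L = x # M"
    by (cases L) auto
  then have "M \<noteq> []"
    using L(5) assms(2) by auto
  have "adj x (hd M)"
    using L(6) M \<open>M \<noteq> []\<close> by (cases M) auto
  moreover have "gray_path (S - {x}) (hd M) y"
    unfolding gray_path_def using L M \<open>M \<noteq> []\<close>
    by (intro exI[of _ M]) (auto simp: successively_Cons)
  ultimately show thesis
    using that by blast
qed

text \<open>Set \<open>S i\<close> is run from \<open>x i\<close> to \<open>y i\<close> for even
  \<open>i\<close> and backwards for odd \<open>i\<close>, so the transitions happen alternately at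
  the \<open>y\<close> ends and at the \<open>x\<close> ends, and the parity of \<open>m\<close>
  decides where the last set is left.\<close>

lemma gray_path_snake:
  assumes "\<And>i. i \<le> m \<Longrightarrow> gray_path (S i) (x i) (y i)"
    and "\<And>i. i < m \<Longrightarrow> adj (x i) (x (Suc i))"
    and "\<And>i. i < m \<Longrightarrow> adj (y i) (y (Suc i))"
    and "\<And>i j. i < j \<Longrightarrow> j \<le> m \<Longrightarrow> S i \<inter> S j = {}"
  shows "gray_path (\<Union>i\<le>m. S i) (x 0) (if even m then y m else x m)"
  using assms
proof (induction m)
  case 0
  then show ?case by simp
next
  case (Suc m)
  have "gray_path (\<Union>i\<le>m. S i) (x 0) (if even m then y m else x m)"
    using Suc.prems by (intro Suc.IH) auto
  moreover have "gray_path (S (Suc m)) (if even m then y (Suc m) else x (Suc m)) (if even m then x (Suc m) else y (Suc m))"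
    using Suc.prems(1)[of "Suc m"] gray_path_rev by auto
  moreover have "adj (if even m then y m else x m) (if even m then y (Suc m) else x (Suc m))"
    using Suc.prems(2,3)[of m] by auto
  moreover have "(\<Union>i\<le>m. S i) \<inter> S (Suc m) = {}"
  proof -
    have "S i \<inter> S (Suc m) = {}" if "i \<le> m" for i
      using Suc.prems(4)[of i "Suc m"] that by simp
    then show ?thesis by blast
  qed
  ultimately have "gray_path ((\<Union>i\<le>m. S i) \<union> S (Suc m)) (x 0) (if even m then x (Suc m) else y (Suc m))"
    by (rule gray_path_join)
  moreover have "(\<Union>i\<le>m. S i) \<union> S (Suc m) = (\<Union>i\<le>Suc m. S i)"
    by (auto simp: atMost_Suc)
  ultimately show ?case
    by (simp split: if_splits)
qed

section \<open>The end words 0(001)* and (001)* as functions of the length\<close>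

text \<open>Truncating with \<open>take\<close> makes length 0 give the empty word, the only element
  of \<open>Zset 0\<close>.\<close>

definition head001 :: "nat \<Rightarrow> nat list" where
  "head001 m = take m (0 # star001 m)"

lemma length_star001 [simp]: "length (star001 m) = m"
  by (simp add: star001_def)

lemma head001_0 [simp]: "head001 0 = []"
  by (simp add: head001_def)

lemma head001_Suc: "head001 (Suc m) = 0 # star001 m"
  by (simp add: head001_def star001_def take_map)

lemma star001_small [simp]: "star001 0 = []" "star001 (Suc 0) = [0]" "star001 (Suc (Suc 0)) = [0, 0]"
  by (simp_all add: star001_def)

lemma star001_add3: "star001 (m + 3) = 0 # 0 # 1 # star001 m"
proof (rule nth_equalityI)
  fix i assume "i < length (star001 (m + 3))"
  then have *: "i < m + 3" by simp
  show "star001 (m + 3) ! i = (0 # 0 # 1 # star001 m) ! i"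
  proof (cases "i < 3")
    case True
    then have "i = 0 \<or> i = 1 \<or> i = 2" by auto
    with * show ?thesis by (auto simp: star001_def nth_append)
  next
    case False
    then obtain k where k: "i = k + 3"
      by (metis add.commute le_Suc_ex not_less)
    with * show ?thesis by (simp add: star001_def del: upt_Suc)
  qed
qed simp

section \<open>Membership of the words 0^a 1^b w in \<open>Zset\<close>\<close>

definition cell :: "nat \<Rightarrow> nat \<Rightarrow> nat list \<Rightarrow> nat list" where
  "cell a b w = replicate a 0 @ replicate b 1 @ w"

lemma length_cell [simp]: "length (cell a b w) = a + b + length w"
  by (simp add: cell_def)

lemma cell_nth:
  "p < a \<Longrightarrow> cell a b w ! p = 0"
  "a \<le> p \<Longrightarrow> p < a + b \<Longrightarrow> cell a b w ! p = 1"
  "a + b \<le> p \<Longrightarrow> cell a b w ! p = w ! (p - (a + b))"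
  by (auto simp: cell_def nth_append)

text \<open>Since \<open>b > 0\<close> and \<open>w\<close> does not start with 1, no run crosses
  position \<open>a + b\<close>. The pairs of runs are thus the leading one, which contributes
  \<open>b < a\<close>, and those of \<open>w\<close> shifted by \<open>a + b\<close>.\<close>

lemma one_decreasing_cell:
  assumes "0 < a" "0 < b" and w: "w = [] \<or> hd w = 0"
  shows "one_decreasing (cell a b w) \<longleftrightarrow> b < a \<and> one_decreasing w"
proof
  let ?u = "cell a b w"
  have len: "length ?u = a + b + length w" by simp
  have w0: "w = [] \<or> w ! 0 = 0"
    using w hd_conv_nth[of w] by metis
  assume L: "one_decreasing ?u"
  have "b < a"
  proof -
    have "a + b - a < a - 0"
      using L assms(1,2) w0 unfolding one_decreasing_def
      by (elim allE[of _ 0] allE[of _ a] allE[of _ "a + b"]) (auto simp: cell_nth)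
    then show ?thesis by simp
  qed
  moreover have "one_decreasing w"
    unfolding one_decreasing_def
  proof (intro allI impI, elim conjE)
    fix i j k
    assume H: "i < j" "j \<le> k" "k \<le> length w"
      "\<forall>p. i \<le> p \<and> p < j \<longrightarrow> w ! p = 0" "\<forall>p. j \<le> p \<and> p < k \<longrightarrow> w ! p = 1"
      "i = 0 \<or> w ! (i - 1) \<noteq> 0" "j = length w \<or> w ! j \<noteq> 0" "k = length w \<or> w ! k \<noteq> 1"
    let ?c = "a + b"
    have 1: "\<forall>p. ?c + i \<le> p \<and> p < ?c + j \<longrightarrow> ?u ! p = 0"
      by (auto simp: cell_nth intro!: H(4)[rule_format])
    have 2: "\<forall>p. ?c + j \<le> p \<and> p < ?c + k \<longrightarrow> ?u ! p = 1"
    proof (intro allI impI)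
      fix p assume "?c + j \<le> p \<and> p < ?c + k"
      then have "?c \<le> p" "j \<le> p - ?c \<and> p - ?c < k" by auto
      then show "?u ! p = 1"
        using H(5) by (simp only: cell_nth(3))
    qed
    \<comment> \<open>Maximality to the left survives the shift even for \<open>i = 0\<close>,
      because the preceding letter is then the last of the \<open>b > 0\<close> ones.\<close>
    have 3: "?u ! (?c + i - 1) \<noteq> 0"
    proof (cases "i = 0")
      case True
      then show ?thesis using assms(1,2) by (auto simp: cell_nth)
    next
      case False
      then have "?c + i - 1 - ?c = i - 1" "?c \<le> ?c + i - 1" by auto
      then show ?thesis using H(6) False by (simp add: cell_nth(3))
    qed
    have 4: "?c + j = length ?u \<or> ?u ! (?c + j) \<noteq> 0"
      using H(7) by (auto simp: cell_nth)
    have 5: "?c + k = length ?u \<or> ?u ! (?c + k) \<noteq> 1"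
      using H(8) by (auto simp: cell_nth)
    have "(?c + k) - (?c + j) < (?c + j) - (?c + i)"
      using L[unfolded one_decreasing_def, rule_format, of "?c + i" "?c + j" "?c + k"] 1 2 3 4 5 H(1-3)
      by simp
    then show "k - j < j - i" by simp
  qed
  ultimately show "b < a \<and> one_decreasing w" ..
next
  let ?u = "cell a b w"
  have w0: "w = [] \<or> w ! 0 = 0"
    using w hd_conv_nth[of w] by metis
  assume R: "b < a \<and> one_decreasing w"
  show "one_decreasing ?u"
    unfolding one_decreasing_def
  proof (intro allI impI, elim conjE)
    fix i j k
    assume H: "i < j" "j \<le> k" "k \<le> length ?u"
      "\<forall>p. i \<le> p \<and> p < j \<longrightarrow> ?u ! p = 0" "\<forall>p. j \<le> p \<and> p < k \<longrightarrow> ?u ! p = 1"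
      "i = 0 \<or> ?u ! (i - 1) \<noteq> 0" "j = length ?u \<or> ?u ! j \<noteq> 0" "k = length ?u \<or> ?u ! k \<noteq> 1"
    have ui: "?u ! i = 0" using H(1,4) by auto
    \<comment> \<open>A maximal run of 0s starting before \<open>a\<close> is the leading one, none
      can start among the 1s, and any later one is a run of \<open>w\<close>.\<close>
    consider "i < a" | "a \<le> i" "i < a + b" | "a + b \<le> i" by linarith
    then show "k - j < j - i"
    proof cases
      case 1
      have "i = 0"
      proof (rule ccontr)
        assume "i \<noteq> 0"
        then have "?u ! (i - 1) = 0" using 1 by (simp add: cell_nth)
        then show False using H(6) \<open>i \<noteq> 0\<close> by simp
      qed
      have "j \<le> a"
      proof (rule ccontr)
        assume "\<not> j \<le> a"
        then have "?u ! a = 0" using H(4) \<open>i = 0\<close> by auto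
        then show False using cell_nth(2)[of a a b w] assms by simp
      qed
      moreover have "\<not> j < a"
        using H(7) cell_nth(1)[of j a b w] by auto
      ultimately have "j = a" by simp
      have "k \<le> a + b"
      proof (rule ccontr)
        assume *: "\<not> k \<le> a + b"
        then have "?u ! (a + b) = 1" using H(5) \<open>j = a\<close> by auto
        moreover have "w \<noteq> []" using * H(3) by auto
        ultimately show False using w0 cell_nth(3)[of a b "a + b" w] by simp
      qed
      then show ?thesis using R \<open>i = 0\<close> \<open>j = a\<close> by linarith
    next
      case 2
      then show ?thesis using ui by (simp add: cell_nth)
    next
      case 3
      let ?c = "a + b"
      obtain i' where i': "i = ?c + i'" using 3 le_Suc_ex by blast
      obtain j' where j': "j = ?c + j'" using 3 H(1) le_Suc_ex by (metis less_imp_le le_trans)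
      obtain k' where k': "k = ?c + k'" using 3 H(1,2) le_Suc_ex by (metis less_imp_le le_trans)
      have sh: "?u ! (?c + p) = w ! p" for p by (simp add: cell_nth)
      have p1: "\<forall>p. i' \<le> p \<and> p < j' \<longrightarrow> w ! p = 0"
        using H(4) i' j' sh by (metis add_le_cancel_left add_less_cancel_left)
      have p2: "\<forall>p. j' \<le> p \<and> p < k' \<longrightarrow> w ! p = 1"
        using H(5) k' j' sh by (metis add_le_cancel_left add_less_cancel_left)
      have p3: "i' = 0 \<or> w ! (i' - 1) \<noteq> 0"
      proof (cases i')
        case (Suc l)
        then show ?thesis using H(6) i' sh[of l] by simp
      qed simp
      have p4: "j' = length w \<or> w ! j' \<noteq> 0" "k' = length w \<or> w ! k' \<noteq> 1"
        using H(7,8) j' k' sh by auto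
      have "k' - j' < j' - i'"
        using R[THEN conjunct2, unfolded one_decreasing_def, rule_format, of i' j' k']
          p1 p2 p3 p4 H(1-3) i' j' k' by simp
      then show ?thesis using i' j' k' by simp
    qed
  qed
qed

lemma one_decreasing_zeros: "one_decreasing (replicate n 0)"
  unfolding one_decreasing_def
proof (intro allI impI, elim conjE)
  fix i j k
  assume H: "i < j" "j \<le> k" "k \<le> length (replicate n (0::nat))"
    "\<forall>p. j \<le> p \<and> p < k \<longrightarrow> replicate n (0::nat) ! p = 1"
  have "j = k"
  proof (rule ccontr)
    assume "j \<noteq> k"
    then have "replicate n (0::nat) ! j = 1" using H by auto
    then show False using \<open>j \<noteq> k\<close> H(2,3) by simp
  qed
  then show "k - j < j - i" using H(1) by simp
qed

lemma Zset_head: "w \<in> Zset m \<Longrightarrow> w = [] \<or> hd w = 0"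
  by (cases w) (auto simp: Zset_def)

lemma cell_in_Zset:
  assumes "w \<in> Zset m" "0 < b" "b < a" "n = a + b + m"
  shows "cell a b w \<in> Zset n"
proof -
  have "one_decreasing (cell a b w)"
    using assms one_decreasing_cell[of a b w] Zset_head[of w m] by (auto simp: Zset_def)
  then show ?thesis
    using assms by (auto simp: Zset_def binary_word_def cell_def split: if_splits)
qed

lemma zeros_in_Zset: "replicate n 0 \<in> Zset n"
  using one_decreasing_zeros by (auto simp: Zset_def binary_word_def)

lemma leading_run:
  obtains k u where "w = replicate k c @ u" "u = [] \<or> hd u \<noteq> c"
proof (induction w arbitrary: thesis)
  case Nil
  then show ?case by (metis append_Nil replicate_0)
next
  case (Cons x w)
  show ?case
  proof (cases "x = c")
    case True
    obtain k u where "w = replicate k c @ u" "u = [] \<or> hd u \<noteq> c"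
      using Cons.IH by blast
    then show ?thesis
      using Cons.prems[of "Suc k" u] True by simp
  next
    case False
    then show ?thesis
      using Cons.prems[of 0 "x # w"] by simp
  qed
qed

text \<open>Peel off the leading run of 0s and then the run of 1s. By maximality the remainder is
  empty or starts with 0, so \<open>one_decreasing_cell\<close> applies to it.\<close>

lemma Zset_cases:
  assumes "w \<in> Zset n"
  obtains "w = replicate n 0"
  | a b v where "w = cell a b v" "0 < b" "b < a" "a + b \<le> n" "v \<in> Zset (n - (a + b))"
proof -
  obtain a r where wr: "w = replicate a 0 @ r" "r = [] \<or> hd r \<noteq> 0"
    by (rule leading_run)
  obtain b v where rv: "r = replicate b 1 @ v" "v = [] \<or> hd v \<noteq> 1"
    by (rule leading_run)
  have bin: "set w \<subseteq> {0, 1}" and len: "length w = n" and od: "one_decreasing w"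
    and h: "1 \<le> n \<longrightarrow> hd w = 0"
    using assms by (auto simp: Zset_def binary_word_def)
  show thesis
  proof (cases "r = []")
    case True
    then show thesis using wr len that(1) by simp
  next
    case False
    have wv: "w = cell a b v" unfolding cell_def using wr rv by simp
    have "hd r \<in> set w" using False wr by simp
    then have r1: "hd r = 1" using bin wr(2) False by auto
    have v: "v = [] \<or> hd v = 0"
    proof (cases "v = []")
      case False
      then have "hd v \<in> set w" using wr rv by simp
      then show ?thesis using bin rv(2) False by auto
    qed simp
    have b: "0 < b" using r1 v rv False by (cases b) auto
    have a: "0 < a" using h len wr r1 False by (cases a; cases r) auto
    have od': "b < a \<and> one_decreasing v"
      using od one_decreasing_cell[OF a b v] wv by simp
    have len': "a + b + length v = n"
      using len wv by simp
    have "set v \<subseteq> {0, 1}" using bin wr rv by auto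
    then have "v \<in> Zset (n - (a + b))"
      using od' len' v by (auto simp: Zset_def binary_word_def)
    then show thesis
      using that(2)[OF wv b] od' len' by simp
  qed
qed

section \<open>Run lengths, rows and levels\<close>

text \<open>With \<open>ones\<close>, this recovers the level and row of a word, so disjointness of
  rows and levels reduces to comparing numbers. The all-zero word is recognised by
  \<open>ones\<close> being 0.\<close>

definition zeros :: "nat list \<Rightarrow> nat" where
  "zeros w = length (takeWhile (\<lambda>x. x = 0) w)"

definition ones :: "nat list \<Rightarrow> nat" where
  "ones w = length (takeWhile (\<lambda>x. x = 1) (dropWhile (\<lambda>x. x = 0) w))"

lemma zeros_ones_cell:
  assumes "w = [] \<or> hd w = 0" "0 < b"
  shows "zeros (cell a b w) = a" "ones (cell a b w) = b"
proof -
  have tw: "takeWhile P (replicate k c @ u) = replicate k c @ takeWhile P u" if "P c" for P k u and c :: nat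
    using that by (induction k) auto
  have dw: "dropWhile P (replicate k c @ u) = dropWhile P u" if "P c" for P k u and c :: nat
    using that by (induction k) auto
  obtain b' where b': "b = Suc b'" using assms(2) by (cases b) auto
  show "zeros (cell a b w) = a"
    by (simp add: zeros_def cell_def tw b')
  have "takeWhile (\<lambda>x. x = 1) w = []"
    using assms(1) by (cases w) auto
  then show "ones (cell a b w) = b"
    unfolding ones_def cell_def by (simp add: dw tw b')
qed

lemma ones_zeros: "ones (replicate n 0) = 0"
  by (induction n) (auto simp: ones_def)

text \<open>Within level \<open>s\<close>, row \<open>i\<close> consists of the words \<open>0\<^sup>a1\<^sup>bw\<close> with \<open>b = i + 1\<close> and
  \<open>a = s - b\<close>; the rows are \<open>i < rows s\<close>, which is the condition \<open>b < a\<close>.\<close>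

definition block_word :: "nat \<Rightarrow> nat \<Rightarrow> nat list \<Rightarrow> nat list" where
  "block_word s i w = cell (s - Suc i) (Suc i) w"

definition rows :: "nat \<Rightarrow> nat" where
  "rows s = (s - 1) div 2"

definition block :: "nat \<Rightarrow> nat \<Rightarrow> nat \<Rightarrow> nat list set" where
  "block n s i = block_word s i ` Zset (n - s)"

definition level :: "nat \<Rightarrow> nat \<Rightarrow> nat list set" where
  "level n s = (\<Union>i<rows s. block n s i)"

text \<open>Including the all-zero word keeps the set nonempty for \<open>t > n\<close>, where it is
  a one-word path.\<close>

definition levels_from :: "nat \<Rightarrow> nat \<Rightarrow> nat list set" where
  "levels_from n t = insert (replicate n 0) (\<Union>s\<in>{t..n}. level n s)"

text \<open>Together with \<open>star_at\<close>: the two ends of row \<open>i\<close> of level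
  \<open>s\<close>, inherited from the path through \<open>Zset (n - s)\<close>.\<close>

definition head_at :: "nat \<Rightarrow> nat \<Rightarrow> nat \<Rightarrow> nat list" where
  "head_at n s i = block_word s i (head001 (n - s))"

definition star_at :: "nat \<Rightarrow> nat \<Rightarrow> nat \<Rightarrow> nat list" where
  "star_at n s i = block_word s i (star001 (n - s))"

lemma rows_less: "i < rows s \<Longrightarrow> Suc i < s"
  by (auto simp: rows_def)

lemma block_statistics:
  assumes "w \<in> block n s i" "Suc i \<le> s"
  shows "ones w = Suc i \<and> zeros w + ones w = s"
proof -
  from assms(1) obtain v where v: "v \<in> Zset (n - s)" "w = cell (s - Suc i) (Suc i) v"
    by (auto simp: block_def block_word_def)
  show ?thesis
    using zeros_ones_cell[OF Zset_head[OF v(1)], of "Suc i" "s - Suc i"] v(2) assms(2) by simp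
qed

lemma level_statistics:
  assumes "w \<in> level n s"
  shows "0 < ones w \<and> zeros w + ones w = s"
proof -
  from assms obtain i where "i < rows s" "w \<in> block n s i"
    by (auto simp: level_def)
  moreover then have "Suc i \<le> s"
    using rows_less by fastforce
  ultimately show ?thesis
    using block_statistics by force
qed

lemma levels_from_statistics: "w \<in> levels_from n t \<Longrightarrow> ones w = 0 \<or> t \<le> zeros w + ones w"
  using ones_zeros by (auto simp: levels_from_def dest: level_statistics)

lemma levels_from_unfold: "t \<le> n \<Longrightarrow> levels_from n t = level n t \<union> levels_from n (Suc t)"
proof -
  assume "t \<le> n"
  then have "{t..n} = insert t {Suc t..n}" by auto
  then show ?thesis by (auto simp: levels_from_def)
qed

lemma levels_from_beyond: "n < t \<Longrightarrow> levels_from n t = {replicate n 0}"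
  by (simp add: levels_from_def)

text \<open>The conditions \<open>0 < b\<close> and \<open>b < a\<close> exclude every level below
  3.\<close>

lemma Zset_eq_levels_from: "Zset n = levels_from n 3"
proof (intro equalityI subsetI)
  fix w assume "w \<in> Zset n"
  then show "w \<in> levels_from n 3"
  proof (cases rule: Zset_cases)
    case (2 a b v)
    have "w \<in> block n (a + b) (b - 1)"
      using 2 by (auto simp: block_def block_word_def)
    moreover have "b - 1 < rows (a + b)"
      using 2 by (auto simp: rows_def)
    ultimately have "w \<in> level n (a + b)"
      by (auto simp: level_def)
    moreover have "a + b \<in> {3..n}" using 2 by auto
    ultimately show ?thesis by (auto simp: levels_from_def)
  qed (simp add: levels_from_def)
next
  fix w assume "w \<in> levels_from n 3"
  then consider "w = replicate n 0" | s where "s \<in> {3..n}" "w \<in> level n s"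
    by (auto simp: levels_from_def)
  then show "w \<in> Zset n"
  proof cases
    case 1
    then show ?thesis by (simp add: zeros_in_Zset)
  next
    case 2
    then obtain i v where i: "i < rows s" "v \<in> Zset (n - s)" "w = cell (s - Suc i) (Suc i) v"
      by (auto simp: level_def block_def block_word_def)
    then show ?thesis
      using 2 by (auto simp: rows_def intro!: cell_in_Zset)
  qed
qed

section \<open>One-letter changes between ends of rows\<close>

lemma adj_block_word_append: "adj u v \<Longrightarrow> adj (block_word s i u) (block_word s i v)"
  unfolding block_word_def cell_def
  using adj_append[of u v "replicate (s - Suc i) 0 @ replicate (Suc i) 1"] by (simp del: replicate_Suc)

lemma inj_block_word: "inj (block_word s i)"
  by (auto simp: inj_def block_word_def cell_def)

lemma adj_cell_zero: "adj (cell a (Suc b) w) (cell (Suc a) b w)"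
  unfolding adj_def cell_def
  by (intro exI[of _ "replicate a 0"] exI[of _ "1"] exI[of _ 0] exI[of _ "replicate b 1 @ w"])
     (simp add: replicate_append_same flip: replicate_Suc append_assoc)

lemma adj_cell_one: "adj (cell a b (0 # w)) (cell a (Suc b) w)"
  unfolding adj_def cell_def
  by (intro exI[of _ "replicate a 0 @ replicate b 1"] exI[of _ "0"] exI[of _ 1] exI[of _ w])
     (simp add: replicate_app_Cons_same)

lemma adj_block_word_Suc: "Suc i < s \<Longrightarrow> adj (block_word s (Suc i) w) (block_word s i w)"
  unfolding block_word_def using adj_cell_zero[of "s - Suc (Suc i)" "Suc i" w] by (simp add: Suc_diff_Suc)

lemma adj_head_at_Suc: "Suc i < s \<Longrightarrow> adj (head_at n s (Suc i)) (head_at n s i)"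
  unfolding head_at_def by (rule adj_block_word_Suc)

lemma adj_star_at_Suc: "Suc i < s \<Longrightarrow> adj (star_at n s (Suc i)) (star_at n s i)"
  unfolding star_at_def by (rule adj_block_word_Suc)

text \<open>A nonempty \<open>head001\<close> opens with a 0; turning it into 1 lengthens the run of
  1s, one level and one row up.\<close>

lemma adj_head_star: "s < n \<Longrightarrow> adj (head_at n s i) (star_at n (Suc s) (Suc i))"
proof -
  assume "s < n"
  then have "head001 (n - s) = 0 # star001 (n - Suc s)"
    by (metis Suc_diff_Suc head001_Suc)
  then show ?thesis
    unfolding head_at_def star_at_def block_word_def by (simp add: adj_cell_one)
qed

text \<open>Row 0 has a single 1 after its zeros; clearing it merges these zeros with
  \<open>w\<close>.\<close>

lemma adj_block_word_zeros: "0 < s \<Longrightarrow> adj (block_word s 0 w) (replicate s 0 @ w)"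
  using adj_cell_zero[of "s - 1" 0 w] by (simp add: block_word_def cell_def)

lemma adj_head_at_zeros: "0 < s \<Longrightarrow> adj (head_at n s 0) (replicate s 0 @ head001 (n - s))"
  unfolding head_at_def by (rule adj_block_word_zeros)

lemma adj_star_at_zeros: "0 < s \<Longrightarrow> adj (star_at n s 0) (replicate s 0 @ star001 (n - s))"
  unfolding star_at_def by (rule adj_block_word_zeros)

text \<open>The first 001 of the star absorbs the zeros in front. With
  \<open>adj_star_at_zeros\<close> this is the jump from level \<open>s\<close> to level
  \<open>s + 3\<close>.\<close>

lemma zeros_star001_long: "s + 3 \<le> n \<Longrightarrow> replicate s 0 @ star001 (n - s) = star_at n (s + 3) 0"
proof -
  assume "s + 3 \<le> n"
  then obtain m where "n = s + 3 + m" using le_Suc_ex by blast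
  then show ?thesis
    using star001_add3[of m] by (simp add: star_at_def block_word_def cell_def add.commute replicate_app_Cons_same)
qed

lemma zeros_star001_short:
  assumes "s \<le> n" "n < s + 3"
  shows "replicate s 0 @ star001 (n - s) = replicate n 0"
proof -
  have "n - s = 0 \<or> n - s = Suc 0 \<or> n - s = Suc (Suc 0)" using assms by auto
  then have "star001 (n - s) = replicate (n - s) 0" by auto
  then show ?thesis using assms by (simp flip: replicate_add)
qed

text \<open>The opening 0 of \<open>head001\<close> joins the zeros before it.\<close>

lemma zeros_head001: "s < n \<Longrightarrow> replicate s 0 @ head001 (n - s) = replicate (Suc s) 0 @ star001 (n - Suc s)"
  by (metis Suc_diff_Suc append_Cons head001_Suc replicate_Suc replicate_app_Cons_same)

text \<open>At most three letters follow, and \<open>head001\<close> has no 1 among its first three.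
  This links 0^n to the levels just below \<open>n\<close>.\<close>

lemma adj_head_at_all_zeros:
  assumes "0 < s" "s < n" "n < s + 4"
  shows "adj (head_at n s 0) (replicate n 0)"
proof -
  have "replicate s 0 @ head001 (n - s) = replicate n 0"
    unfolding zeros_head001[OF assms(2)] using assms by (intro zeros_star001_short) auto
  then show ?thesis
    using adj_head_at_zeros[OF assms(1), of n] by simp
qed

lemma head001_eq_star001: "m < 3 \<Longrightarrow> head001 m = star001 m"
proof -
  assume "m < 3"
  then have "m = 0 \<or> m = Suc 0 \<or> m = Suc (Suc 0)" by auto
  then show ?thesis by (auto simp: head001_Suc)
qed

lemma head001_neq_star001: "3 \<le> m \<Longrightarrow> head001 m \<noteq> star001 m"
proof -
  assume "3 \<le> m"
  then have "head001 m ! 2 = 0" "star001 m ! 2 = 1"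
    by (simp_all add: head001_def star001_def numeral_2_eq_2)
  then show ?thesis by auto
qed

lemma head_at_eq_star_at: "n < s + 3 \<Longrightarrow> head_at n s i = star_at n s i"
  by (simp add: head_at_def star_at_def head001_eq_star001)

section \<open>Paths through rows and single levels, given the paths for all shorter lengths\<close>

context
  fixes n :: nat
  assumes IH: "\<And>m. m < n \<Longrightarrow> gray_path (Zset m) (head001 m) (star001 m)"
begin

lemma gray_path_block: "0 < s \<Longrightarrow> s \<le> n \<Longrightarrow> gray_path (block n s i) (star_at n s i) (head_at n s i)"
  unfolding block_def head_at_def star_at_def
  by (intro gray_path_image gray_path_rev[OF IH] inj_block_word adj_block_word_append) auto

lemma block_disjoint: "i \<noteq> j \<Longrightarrow> i < s \<Longrightarrow> j < s \<Longrightarrow> block n s i \<inter> block n s j = {}"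
  by (auto dest!: block_statistics)

text \<open>The rows are snaked upwards from row 0. Each row switches between the two kinds of end,
  so the parity of the number of rows fixes the final one.\<close>

lemma gray_path_level_star:
  assumes "3 \<le> s" "s \<le> n"
  shows "gray_path (level n s) (star_at n s 0) (if odd (rows s) then head_at n s (rows s - 1) else star_at n s (rows s - 1))"
proof -
  obtain m where m: "rows s = Suc m"
    using assms(1) by (cases "rows s") (auto simp: rows_def)
  have ms: "Suc m < s" using m by (auto simp: rows_def)
  have "gray_path (\<Union>i\<le>m. block n s i) (star_at n s 0) (if even m then head_at n s m else star_at n s m)"
    using assms ms by (intro gray_path_snake gray_path_block block_disjoint adj_sym[OF adj_head_at_Suc] adj_sym[OF adj_star_at_Suc]) auto
  then show ?thesis by (cases "even m") (simp_all add: level_def m lessThan_Suc_atMost)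
qed

lemma gray_path_level_head:
  assumes "3 \<le> s" "s \<le> n"
  shows "gray_path (level n s) (head_at n s 0) (if odd (rows s) then star_at n s (rows s - 1) else head_at n s (rows s - 1))"
proof -
  obtain m where m: "rows s = Suc m"
    using assms(1) by (cases "rows s") (auto simp: rows_def)
  have ms: "Suc m < s" using m by (auto simp: rows_def)
  have "gray_path (\<Union>i\<le>m. block n s i) (head_at n s 0) (if even m then star_at n s m else head_at n s m)"
    using assms ms by (intro gray_path_snake gray_path_rev[OF gray_path_block] block_disjoint adj_sym[OF adj_head_at_Suc] adj_sym[OF adj_star_at_Suc]) auto
  then show ?thesis by (cases "even m") (simp_all add: level_def m lessThan_Suc_atMost)
qed

lemma level_disjoint: "s \<noteq> s' \<Longrightarrow> level n s \<inter> level n s' = {}"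
  by (auto dest!: level_statistics)

text \<open>Level \<open>t\<close> has the odd number \<open>2 * m - 1\<close> of rows, so its climb
  ends at the head end of the top row, next to the star end of the top row of level
  \<open>t + 1\<close>. That level has \<open>2 * m\<close> rows, and this even number brings the
  descent to a star end.\<close>

lemma gray_path_forward:
  assumes "0 < m" "t = 4 * m" "t < n"
  shows "gray_path (level n t \<union> level n (t + 1)) (star_at n t 0) (star_at n (t + 1) 0)"
proof -
  obtain k where k: "m = Suc k"
    using assms(1) by (cases m) auto
  have r: "odd (rows t)" "rows t - 1 = 2 * m - 2" "rows (t + 1) = 2 * m"
    unfolding assms(2) k rows_def by presburger+
  have "gray_path (level n t) (star_at n t 0) (head_at n t (2 * m - 2))"
    using gray_path_level_star[of t] assms r(1,2) by simp
  moreover have "gray_path (level n (t + 1)) (star_at n (t + 1) (2 * m - 1)) (star_at n (t + 1) 0)"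
    using gray_path_rev[OF gray_path_level_star[of "t + 1"]] assms r by simp
  moreover have "adj (head_at n t (2 * m - 2)) (star_at n (t + 1) (2 * m - 1))"
  proof -
    have "2 * m - 1 = Suc (2 * m - 2)" using assms(1) by simp
    then show ?thesis using adj_head_star[of t n "2 * m - 2"] assms(3) by simp
  qed
  ultimately show ?thesis
    by (rule gray_path_join) (auto intro!: level_disjoint)
qed

text \<open>Level \<open>t + 3\<close> has an odd number of rows, so a descent from the star end of
  its top row finishes at the head end of row 0. For \<open>n < t + 6\<close> this is also the star
  end, as rows there have one word.\<close>

lemma gray_path_return_short:
  assumes "0 < m" "t = 4 * m" "t + 3 \<le> n" "n < t + 6"
  shows "gray_path (level n (t + 2) \<union> level n (t + 3)) (head_at n (t + 2) 0) (star_at n (t + 3) 0)"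
proof -
  have r: "rows (t + 2) = 2 * m" "rows (t + 3) = 2 * m + 1"
    using assms(1,2) by (auto simp: rows_def)
  have "gray_path (level n (t + 2)) (head_at n (t + 2) 0) (head_at n (t + 2) (2 * m - 1))"
    using gray_path_level_head[of "t + 2"] assms r by simp
  moreover have "gray_path (level n (t + 3)) (star_at n (t + 3) (2 * m)) (star_at n (t + 3) 0)"
    using gray_path_rev[OF gray_path_level_head[of "t + 3"]] assms r by (simp add: head_at_eq_star_at)
  moreover have "adj (head_at n (t + 2) (2 * m - 1)) (star_at n (t + 3) (2 * m))"
    using adj_head_star[of "t + 2" n "2 * m - 1"] assms(1,3) by (simp add: numeral_3_eq_3)
  ultimately show ?thesis
    by (rule gray_path_join) (auto intro!: level_disjoint)
qed

text \<open>Starting at the prescribed last word, the reversed path reads only the first words of rows 0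
  and 1 of level \<open>t + 3\<close>, covers level \<open>t + 2\<close>, and descends level \<open>t + 3\<close> from its top row; the
  remainders of rows 1 and 0 come last. This requires row 0 to have at least two words, hence
  \<open>t + 6 \<le> n\<close>.\<close>

lemma gray_path_return_long:
  assumes "0 < m" "t = 4 * m" "t + 6 \<le> n"
  shows "gray_path (level n (t + 2) \<union> level n (t + 3)) (head_at n (t + 3) 0) (star_at n (t + 3) 0)"
proof -
  let ?s = "t + 3"
  let ?Z = "Zset (n - ?s)"
  let ?B = "star001 (n - ?s)"
  have r: "rows (t + 2) = 2 * m" "rows ?s = 2 * m + 1"
    using assms(1,2) by (auto simp: rows_def)
  have ZB: "gray_path ?Z ?B (head001 (n - ?s))"
    using assms by (intro gray_path_rev[OF IH]) auto
  \<comment> \<open>Here \<open>t + 6 \<le> n\<close> is used: at least three letters remain, so the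
    ends of a row differ.\<close>
  moreover have "?B \<noteq> head001 (n - ?s)"
    using head001_neq_star001[of "n - ?s"] assms(3) by force
  ultimately obtain z where z: "gray_path (?Z - {?B}) z (head001 (n - ?s))"
    by (rule gray_path_remove_first)
  define U where "U i = block_word ?s i ` (?Z - {?B})" for i
  have U: "gray_path (U i) (block_word ?s i z) (head_at n ?s i)" for i
    unfolding U_def head_at_def by (intro gray_path_image z inj_block_word adj_block_word_append)
  have blockU: "block n ?s i = insert (star_at n ?s i) (U i)" for i
    using gray_path_mem[OF ZB] by (auto simp: block_def U_def star_at_def)
  have nU: "star_at n ?s i \<notin> U i" for i
    using inj_block_word[of ?s i] by (auto simp: U_def star_at_def inj_def)
  \<comment> \<open>Rows \<open>2 * m\<close> down to 2 of level \<open>t + 3\<close>. Their number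
    \<open>2 * m - 1\<close> is odd, so the descent from a star end leaves row 2 at its head
    end.\<close>
  define R where "R = (\<Union>j\<le>2 * m - 2. block n ?s (2 * m - j))"
  have R: "gray_path R (star_at n ?s (2 * m)) (head_at n ?s 2)"
  proof -
    have "gray_path R (star_at n ?s (2 * m - 0))
       (if even (2 * m - 2) then head_at n ?s (2 * m - (2 * m - 2)) else star_at n ?s (2 * m - (2 * m - 2)))"
      unfolding R_def
    proof (rule gray_path_snake)
      fix i assume "i < 2 * m - 2"
      then have "2 * m - i = Suc (2 * m - Suc i)" "2 * m - i < ?s" using assms(2) by auto
      then show "adj (star_at n ?s (2 * m - i)) (star_at n ?s (2 * m - Suc i))"
        "adj (head_at n ?s (2 * m - i)) (head_at n ?s (2 * m - Suc i))"
        by (simp_all add: adj_head_at_Suc adj_star_at_Suc)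
    next
      fix i j assume "i < j" "j \<le> 2 * m - 2"
      then have "2 * m - i \<noteq> 2 * m - j" "2 * m - i < ?s" "2 * m - j < ?s"
        using assms(2) by auto
      then show "block n ?s (2 * m - i) \<inter> block n ?s (2 * m - j) = {}"
        by (rule block_disjoint)
    qed (use assms in \<open>auto intro!: gray_path_block\<close>)
    moreover have "2 * m - (2 * m - 2) = 2" using assms(1) by simp
    ultimately show ?thesis using assms(1) by simp
  qed
  have Rkey: "2 < ones w \<and> zeros w + ones w = ?s" if w: "w \<in> R" for w
  proof -
    from w obtain j where j: "j \<le> 2 * m - 2" "w \<in> block n ?s (2 * m - j)"
      unfolding R_def by blast
    then have "Suc (2 * m - j) \<le> ?s" "2 \<le> 2 * m - j" using assms(1,2) by auto
    then show ?thesis using block_statistics[OF j(2)] by auto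
  qed
  have key: "ones w = Suc i \<and> zeros w + ones w = ?s" if "w \<in> block n ?s i" "i < 2" for w i
    using block_statistics[OF that(1)] that(2) by auto
  have kU: "ones w = Suc i \<and> zeros w + ones w = ?s" if "w \<in> U i" "i < 2" for w i
    using key[of w i] that blockU by auto
  have kB: "ones (star_at n ?s 0) = 1" "zeros (star_at n ?s 0) + ones (star_at n ?s 0) = ?s"
    "ones (star_at n ?s 1) = 2" "zeros (star_at n ?s 1) + ones (star_at n ?s 1) = ?s"
    using key[of "star_at n ?s 0" 0] key[of "star_at n ?s 1" 1] blockU by auto
  have ne: "star_at n ?s 0 \<noteq> star_at n ?s 1"
    using kB(1,3) by fastforce
  have g: "w \<in> level n (t + 2) \<Longrightarrow> zeros w + ones w = t + 2" for w
    using level_statistics by blast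
  have "gray_path ({star_at n ?s 0} \<union> {star_at n ?s 1}) (star_at n ?s 0) (star_at n ?s 1)"
    using ne adj_sym[OF adj_star_at_Suc[of 0 ?s n]]
    by (intro gray_path_join[OF gray_path_singleton gray_path_singleton]) auto
  moreover have "gray_path (level n (t + 2)) (head_at n (t + 2) 0) (head_at n (t + 2) (2 * m - 1))"
    using gray_path_level_head[of "t + 2"] assms r by simp
  moreover have "adj (star_at n ?s 1) (head_at n (t + 2) 0)"
    using adj_sym[OF adj_head_star[of "t + 2" n 0]] assms(3) by (simp add: numeral_3_eq_3)
  moreover have "({star_at n ?s 0} \<union> {star_at n ?s 1}) \<inter> level n (t + 2) = {}"
    using kB g by fastforce
  ultimately have "gray_path (({star_at n ?s 0} \<union> {star_at n ?s 1}) \<union> level n (t + 2)) (star_at n ?s 0) (head_at n (t + 2) (2 * m - 1))"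
    by (rule gray_path_join)
  moreover have "adj (head_at n (t + 2) (2 * m - 1)) (star_at n ?s (2 * m))"
    using adj_head_star[of "t + 2" n "2 * m - 1"] assms(1,3) by (simp add: numeral_3_eq_3)
  moreover have "(({star_at n ?s 0} \<union> {star_at n ?s 1}) \<union> level n (t + 2)) \<inter> R = {}"
  proof -
    have "star_at n ?s 0 \<notin> R" "star_at n ?s 1 \<notin> R"
      using Rkey kB by fastforce+
    moreover have "level n (t + 2) \<inter> R = {}"
      using Rkey g by fastforce
    ultimately show ?thesis by blast
  qed
  ultimately have "gray_path ((({star_at n ?s 0} \<union> {star_at n ?s 1}) \<union> level n (t + 2)) \<union> R) (star_at n ?s 0) (head_at n ?s 2)"
    using gray_path_join[OF _ R] by blast
  moreover have "adj (head_at n ?s 2) (head_at n ?s 1)"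
    using adj_head_at_Suc[of 1 ?s n] by (simp add: numeral_2_eq_2)
  moreover have "((({star_at n ?s 0} \<union> {star_at n ?s 1}) \<union> level n (t + 2)) \<union> R) \<inter> U 1 = {}"
  proof -
    have "star_at n ?s 0 \<notin> U 1"
      using kU[of "star_at n ?s 0" 1] kB by auto
    moreover have "level n (t + 2) \<inter> U 1 = {}" "R \<inter> U 1 = {}"
      using kU[of _ 1] Rkey g by fastforce+
    ultimately show ?thesis using nU[of 1] by blast
  qed
  ultimately have "gray_path (((({star_at n ?s 0} \<union> {star_at n ?s 1}) \<union> level n (t + 2)) \<union> R) \<union> U 1) (star_at n ?s 0) (block_word ?s 1 z)"
    using gray_path_join[OF _ gray_path_rev[OF U]] by blast
  \<comment> \<open>Rows 1 and 0 were cut at the same word, so their remainders meet at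
    \<open>z\<close>.\<close>
  moreover have "adj (block_word ?s 1 z) (block_word ?s 0 z)"
    using adj_block_word_Suc[of 0 ?s z] by simp
  moreover have "(((({star_at n ?s 0} \<union> {star_at n ?s 1}) \<union> level n (t + 2)) \<union> R) \<union> U 1) \<inter> U 0 = {}"
  proof -
    have "star_at n ?s 1 \<notin> U 0"
      using kU[of "star_at n ?s 1" 0] kB by auto
    moreover have "level n (t + 2) \<inter> U 0 = {}" "R \<inter> U 0 = {}" "U 1 \<inter> U 0 = {}"
      using kU[of _ 0] kU[of _ 1] Rkey g by fastforce+
    ultimately show ?thesis using nU[of 0] by blast
  qed
  ultimately have "gray_path ((((({star_at n ?s 0} \<union> {star_at n ?s 1}) \<union> level n (t + 2)) \<union> R) \<union> U 1) \<union> U 0) (star_at n ?s 0) (head_at n ?s 0)"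
    using gray_path_join[OF _ U] by blast
  moreover have "level n ?s = block n ?s 0 \<union> block n ?s 1 \<union> R"
  proof -
    have "{..<2 * m + 1} = {0, 1} \<union> (\<lambda>j. 2 * m - j) ` {..2 * m - 2}"
    proof (intro equalityI subsetI)
      fix i assume i: "i \<in> {..<2 * m + 1}"
      show "i \<in> {0, 1} \<union> (\<lambda>j. 2 * m - j) ` {..2 * m - 2}"
      proof (cases "i < 2")
        case False
        then have "i = 2 * m - (2 * m - i)" "2 * m - i \<in> {..2 * m - 2}" using i by auto
        then show ?thesis by blast
      qed auto
    qed (use assms(1) in auto)
    then show ?thesis unfolding level_def r R_def by auto
  qed
  ultimately have "gray_path (level n (t + 2) \<union> level n ?s) (star_at n ?s 0) (head_at n ?s 0)"
    unfolding blockU by (simp add: Un_ac insert_commute)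
  then show ?thesis by (rule gray_path_rev)
qed

text \<open>Each row of level \<open>s\<close> but the top one is joined to the next higher row of level \<open>s + 1\<close>. The top
  row has no such partner, since \<open>s\<close> is odd.\<close>

lemma gray_path_zigzag:
  assumes "odd s" "5 \<le> s" "s < n" "n < s + 3" "r = rows s - 1"
  shows "gray_path (level n s \<union> (\<Union>i<r. block n (Suc s) (Suc i))) (star_at n s r) (if odd r then head_at n (Suc s) 1 else star_at n s 0)"
proof -
  obtain k where k: "s = 2 * k + 1"
    using assms(1) by (rule oddE)
  have r: "rows s = Suc r" "0 < r" "2 * r + 3 = s"
    using assms(2,5) unfolding k by (auto simp: rows_def)
  \<comment> \<open>Row \<open>i\<close> of level \<open>s\<close> followed by its partner, row
    \<open>i + 1\<close> of level \<open>s + 1\<close>. Row 0 of level \<open>s + 1\<close> stays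
    outside all pairs.\<close>
  define P where "P i = block n s i \<union> block n (Suc s) (Suc i)" for i
  have P: "gray_path (P i) (star_at n s i) (head_at n (Suc s) (Suc i))" if "i < r" for i
    unfolding P_def
  proof (rule gray_path_join[OF gray_path_block gray_path_block adj_head_star])
    show "block n s i \<inter> block n (Suc s) (Suc i) = {}"
      using that r block_statistics[of _ n s i] block_statistics[of _ n "Suc s" "Suc i"] by force
  qed (use assms in auto)
  have Pkey: "w \<in> P i \<Longrightarrow> i < r \<Longrightarrow>
      (zeros w + ones w = s \<and> ones w = Suc i) \<or> (zeros w + ones w = Suc s \<and> ones w = Suc (Suc i))" for w i
    using r block_statistics[of w n s i] block_statistics[of w n "Suc s" "Suc i"] unfolding P_def by auto
  \<comment> \<open>The pairs are snaked downwards from \<open>P (r - 1)\<close> to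
    \<open>P 0\<close>; the parity of their number \<open>r\<close> selects the end.\<close>
  have "gray_path (\<Union>j\<le>r - 1. P (r - 1 - j)) (star_at n s (r - 1 - 0))
      (if even (r - 1) then head_at n (Suc s) (Suc (r - 1 - (r - 1))) else star_at n s (r - 1 - (r - 1)))"
  proof (rule gray_path_snake[where y = "\<lambda>j. head_at n (Suc s) (Suc (r - 1 - j))"])
    fix i assume "i < r - 1"
    then have "r - 1 - i = Suc (r - 1 - Suc i)" "r - 1 - i < s" using r by auto
    then show "adj (star_at n s (r - 1 - i)) (star_at n s (r - 1 - Suc i))"
      "adj (head_at n (Suc s) (Suc (r - 1 - i))) (head_at n (Suc s) (Suc (r - 1 - Suc i)))"
      by (simp_all add: adj_head_at_Suc adj_star_at_Suc)
  next
    fix i j assume ij: "i < j" "j \<le> r - 1"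
    then have "r - 1 - i < r" "r - 1 - j < r" "r - 1 - i \<noteq> r - 1 - j" using r by auto
    then show "P (r - 1 - i) \<inter> P (r - 1 - j) = {}"
      using Pkey[of _ "r - 1 - i"] Pkey[of _ "r - 1 - j"] by force
  qed (use r(2) in \<open>auto intro!: P\<close>)
  moreover have "(\<Union>j\<le>r - 1. P (r - 1 - j)) = (\<Union>i<r. P i)"
  proof -
    have "(\<lambda>j. r - 1 - j) ` {..r - 1} = {..<r}"
    proof (intro equalityI subsetI)
      fix i assume "i \<in> {..<r}"
      then have "i = r - 1 - (r - 1 - i)" "r - 1 - i \<in> {..r - 1}" by auto
      then show "i \<in> (\<lambda>j. r - 1 - j) ` {..r - 1}" by blast
    qed (use r in auto)
    then show ?thesis by (metis image_image)
  qed
  ultimately have Q: "gray_path (\<Union>i<r. P i) (star_at n s (r - 1)) (if odd r then head_at n (Suc s) 1 else star_at n s 0)"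
    using r by (auto split: if_splits)
  have "gray_path (block n s r \<union> (\<Union>i<r. P i)) (star_at n s r) (if odd r then head_at n (Suc s) 1 else star_at n s 0)"
  proof (rule gray_path_join[OF gray_path_block Q])
    \<comment> \<open>For \<open>n < s + 3\<close> the ends of a row coincide, so the unpartnered
      top row can be left at its star end.\<close>
    show "adj (head_at n s r) (star_at n s (r - 1))"
      using adj_star_at_Suc[of "r - 1" s n] r assms(4) by (simp add: head_at_eq_star_at)
    show "block n s r \<inter> (\<Union>i<r. P i) = {}"
      using r block_statistics[of _ n s r] Pkey by fastforce
  qed (use assms in auto)
  moreover have "block n s r \<union> (\<Union>i<r. P i) = level n s \<union> (\<Union>i<r. block n (Suc s) (Suc i))"
    unfolding level_def r P_def by (auto simp: lessThan_Suc)
  ultimately show ?thesis by simp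
qed

section \<open>Paths through all levels from \<open>t\<close> on\<close>

text \<open>Level \<open>t + 2\<close> is the last one and the path must end at 0^n, so there is no
  return. After level \<open>t\<close>, the zigzag covers level \<open>t + 1\<close> together with
  \<open>V\<close>, all of level \<open>t + 2\<close> except row 0; that row leads on to
  0^n.\<close>

lemma gray_path_levels_from_add2:
  assumes "0 < m" "t = 4 * m" "n = t + 2"
  shows "gray_path (levels_from n t) (star_at n t 0) (replicate n 0)"
proof -
  obtain k where k: "m = Suc k"
    using assms(1) by (cases m) auto
  have r: "odd (rows t)" "rows t - 1 = 2 * m - 2" "rows (t + 1) = 2 * m" "rows (t + 2) = 2 * m"
    unfolding assms(2) k rows_def by presburger+
  define V where "V = (\<Union>i<2 * m - 1. block n (t + 2) (Suc i))"
  define W where "W = block n (t + 2) 0"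
  let ?G = "level n (t + 1) \<union> V"
  have b: "level n (t + 2) = W \<union> V"
  proof -
    have "{..<2 * m} = insert 0 (Suc ` {..<2 * m - 1})"
      by (simp add: k lessThan_Suc_eq_insert_0)
    then show ?thesis unfolding level_def r V_def W_def by simp
  qed
  have kV: "1 < ones w \<and> zeros w + ones w = t + 2" if w: "w \<in> V" for w
  proof -
    obtain i where i: "i < 2 * m - 1" "w \<in> block n (t + 2) (Suc i)"
      using w unfolding V_def by blast
    then have "Suc (Suc i) \<le> t + 2" using assms(2) by linarith
    then show ?thesis using block_statistics[OF i(2)] by simp
  qed
  have kW: "ones w = 1 \<and> zeros w + ones w = t + 2" if "w \<in> W" for w
    using block_statistics[of w n "t + 2" 0] that unfolding W_def by simp
  have "gray_path (level n t) (star_at n t 0) (head_at n t (2 * m - 2))"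
    using gray_path_level_star[of t] assms r(1,2) by simp
  moreover have "gray_path ?G (star_at n (t + 1) (2 * m - 1)) (head_at n (t + 2) 1)"
  proof -
    have "gray_path (level n (t + 1) \<union> (\<Union>i<2 * m - 1. block n (Suc (t + 1)) (Suc i))) (star_at n (t + 1) (2 * m - 1))
        (if odd (2 * m - 1) then head_at n (Suc (t + 1)) 1 else star_at n (t + 1) 0)"
      using assms r(3) by (intro gray_path_zigzag) auto
    moreover have "odd (2 * m - 1)" "Suc (t + 1) = t + 2"
      by (simp_all add: k)
    ultimately show ?thesis unfolding V_def by simp
  qed
  moreover have "adj (head_at n t (2 * m - 2)) (star_at n (t + 1) (2 * m - 1))"
    using adj_head_star[of t n "2 * m - 2"] assms(3) by (simp add: k)
  moreover have "level n t \<inter> ?G = {}"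
    by (auto dest!: level_statistics kV)
  ultimately have "gray_path (level n t \<union> ?G) (star_at n t 0) (head_at n (t + 2) 1)"
    by (rule gray_path_join)
  moreover have "gray_path (W) (head_at n (t + 2) 0) (star_at n (t + 2) 0)"
    using assms unfolding W_def by (intro gray_path_rev[OF gray_path_block]) auto
  moreover have "adj (head_at n (t + 2) 1) (head_at n (t + 2) 0)"
    using adj_head_at_Suc[of 0 "t + 2" n] assms(1,2) by simp
  moreover have "(level n t \<union> ?G) \<inter> W = {}"
    by (auto dest!: level_statistics kV kW)
  ultimately have "gray_path ((level n t \<union> ?G) \<union> W) (star_at n t 0) (star_at n (t + 2) 0)"
    by (rule gray_path_join)
  moreover have "(level n t \<union> ?G) \<union> W = level n t \<union> level n (t + 1) \<union> level n (t + 2)"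
    unfolding b by auto
  ultimately have "gray_path (level n t \<union> level n (t + 1) \<union> level n (t + 2)) (star_at n t 0) (star_at n (t + 2) 0)"
    by simp
  moreover have "adj (star_at n (t + 2) 0) (replicate n 0)"
    using adj_star_at_zeros[of "t + 2" n] assms by simp
  moreover have "(level n t \<union> level n (t + 1) \<union> level n (t + 2)) \<inter> {replicate n 0} = {}"
    using ones_zeros[of n] by (auto dest!: level_statistics)
  ultimately have "gray_path ((level n t \<union> level n (t + 1) \<union> level n (t + 2)) \<union> {replicate n 0}) (star_at n t 0) (replicate n 0)"
    using gray_path_join[OF _ gray_path_singleton] by blast
  moreover have "levels_from n t = (level n t \<union> level n (t + 1) \<union> level n (t + 2)) \<union> {replicate n 0}"
    using assms(3) by (simp add: levels_from_unfold levels_from_beyond Un_ac)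
  ultimately show ?thesis by simp
qed

text \<open>Level \<open>t + 4\<close> equals \<open>n\<close>, too high for the inductive claim.
  Its row 0, the set \<open>W\<close>, bridges the jump from level \<open>t + 1\<close> to 0^n, and
  its other rows \<open>V\<close> are picked up by the zigzag while returning through level
  \<open>t + 3\<close>.\<close>

lemma gray_path_levels_from_add4:
  assumes "0 < m" "t = 4 * m" "n = t + 4"
  shows "gray_path (levels_from n t) (star_at n t 0) (star_at n (t + 3) 0)"
proof -
  obtain k where k: "m = Suc k"
    using assms(1) by (cases m) auto
  have r: "rows (t + 2) = 2 * m" "rows (t + 3) = 2 * m + 1" "rows (t + 4) = 2 * m + 1"
    unfolding assms(2) k rows_def by presburger+
  define V where "V = (\<Union>i<2 * m. block n (t + 4) (Suc i))"
  define W where "W = block n (t + 4) 0"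
  let ?G = "level n (t + 3) \<union> V"
  have b: "level n (t + 4) = W \<union> V"
  proof -
    have "{..<2 * m + 1} = insert 0 (Suc ` {..<2 * m})"
      by (simp add: lessThan_Suc_eq_insert_0)
    then show ?thesis unfolding level_def r V_def W_def by simp
  qed
  have kV: "1 < ones w \<and> zeros w + ones w = t + 4" if w: "w \<in> V" for w
  proof -
    obtain i where i: "i < 2 * m" "w \<in> block n (t + 4) (Suc i)"
      using w unfolding V_def by blast
    then have "Suc (Suc i) \<le> t + 4" using assms(2) by linarith
    then show ?thesis using block_statistics[OF i(2)] by simp
  qed
  have kW: "ones w = 1 \<and> zeros w + ones w = t + 4" if "w \<in> W" for w
    using block_statistics[of w n "t + 4" 0] that unfolding W_def by simp
  let ?F = "level n t \<union> level n (t + 1)"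
  have "gray_path ?F (star_at n t 0) (star_at n (t + 1) 0)"
    using gray_path_forward[of m t] assms by simp
  moreover have "gray_path (W) (star_at n (t + 4) 0) (head_at n (t + 4) 0)"
    using assms unfolding W_def by (intro gray_path_block) auto
  moreover have "adj (star_at n (t + 1) 0) (star_at n (t + 4) 0)"
    using adj_star_at_zeros[of "t + 1" n] zeros_star001_long[of "t + 1" n] assms(3)
    by (simp add: add.commute)
  moreover have "?F \<inter> W = {}"
    by (auto dest!: level_statistics kW)
  ultimately have "gray_path (?F \<union> W) (star_at n t 0) (head_at n (t + 4) 0)"
    by (rule gray_path_join)
  moreover have "adj (head_at n (t + 4) 0) (replicate n 0)"
    using adj_head_at_zeros[of "t + 4" n] assms by simp
  moreover have "(?F \<union> W) \<inter> {replicate n 0} = {}"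
    using ones_zeros[of n] by (auto dest!: level_statistics kW)
  ultimately have "gray_path ((?F \<union> W) \<union> {replicate n 0}) (star_at n t 0) (replicate n 0)"
    using gray_path_join[OF _ gray_path_singleton] by blast
  moreover have "gray_path (level n (t + 2)) (head_at n (t + 2) 0) (head_at n (t + 2) (2 * m - 1))"
    using gray_path_level_head[of "t + 2"] assms r by simp
  moreover have "adj (replicate n 0) (head_at n (t + 2) 0)"
    using assms(3) by (intro adj_sym[OF adj_head_at_all_zeros]) auto
  moreover have "((?F \<union> W) \<union> {replicate n 0}) \<inter> level n (t + 2) = {}"
    using ones_zeros[of n] by (auto dest!: level_statistics kW)
  ultimately have "gray_path (((?F \<union> W) \<union> {replicate n 0}) \<union> level n (t + 2)) (star_at n t 0) (head_at n (t + 2) (2 * m - 1))"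
    by (rule gray_path_join)
  moreover have "gray_path ?G (star_at n (t + 3) (2 * m)) (star_at n (t + 3) 0)"
  proof -
    have "gray_path (level n (t + 3) \<union> (\<Union>i<2 * m. block n (Suc (t + 3)) (Suc i))) (star_at n (t + 3) (2 * m))
        (if odd (2 * m) then head_at n (Suc (t + 3)) 1 else star_at n (t + 3) 0)"
      using assms r(2) by (intro gray_path_zigzag) auto
    moreover have "even (2 * m)" "Suc (t + 3) = t + 4"
      by simp_all
    ultimately show ?thesis unfolding V_def by simp
  qed
  moreover have "adj (head_at n (t + 2) (2 * m - 1)) (star_at n (t + 3) (2 * m))"
    using adj_head_star[of "t + 2" n "2 * m - 1"] assms(1,3) by (simp add: numeral_3_eq_3)
  moreover have "(((?F \<union> W) \<union> {replicate n 0}) \<union> level n (t + 2)) \<inter> ?G = {}"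
    using ones_zeros[of n] by (auto dest!: level_statistics kW kV)
  ultimately have "gray_path ((((?F \<union> W) \<union> {replicate n 0}) \<union> level n (t + 2)) \<union> ?G) (star_at n t 0) (star_at n (t + 3) 0)"
    by (rule gray_path_join)
  moreover have "levels_from n t = (((?F \<union> W) \<union> {replicate n 0}) \<union> level n (t + 2)) \<union> ?G"
  proof -
    have "levels_from n t = level n t \<union> (level n (t + 1) \<union> (level n (t + 2) \<union> (level n (t + 3) \<union> (level n (t + 4) \<union> {replicate n 0}))))"
      using assms(3) by (simp add: levels_from_unfold levels_from_beyond eval_nat_numeral)
    then show ?thesis unfolding b by blast
  qed
  ultimately show ?thesis by simp
qed

text \<open>Glues the forward pass, a path through the levels from \<open>t + 4\<close> on, and a
  return pass. The ends \<open>z\<close> and \<open>z'\<close> are left open because the short and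
  long returns start at different words.\<close>

lemma gray_path_levels_from_extend:
  assumes "0 < m" "t = 4 * m" "t + 3 \<le> n"
    and T: "gray_path (levels_from n (t + 4)) (replicate (t + 1) 0 @ star001 (n - (t + 1))) z"
    and R: "gray_path (level n (t + 2) \<union> level n (t + 3)) z' (star_at n (t + 3) 0)"
    and "adj z z'"
  shows "gray_path (levels_from n t) (star_at n t 0) (star_at n (t + 3) 0)"
proof -
  let ?F = "level n t \<union> level n (t + 1)"
  have "gray_path (?F \<union> levels_from n (t + 4)) (star_at n t 0) z"
  proof (rule gray_path_join[OF gray_path_forward T])
    show "adj (star_at n (t + 1) 0) (replicate (t + 1) 0 @ star001 (n - (t + 1)))"
      by (rule adj_star_at_zeros) simp
    show "?F \<inter> levels_from n (t + 4) = {}"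
      by (auto dest!: level_statistics levels_from_statistics)
  qed (use assms in auto)
  moreover have "(?F \<union> levels_from n (t + 4)) \<inter> (level n (t + 2) \<union> level n (t + 3)) = {}"
    by (auto dest!: level_statistics levels_from_statistics)
  ultimately have "gray_path ((?F \<union> levels_from n (t + 4)) \<union> (level n (t + 2) \<union> level n (t + 3))) (star_at n t 0) (star_at n (t + 3) 0)"
    using gray_path_join[OF _ R] assms(6) by blast
  moreover have "levels_from n t = (?F \<union> levels_from n (t + 4)) \<union> (level n (t + 2) \<union> level n (t + 3))"
  proof -
    have "levels_from n t = level n t \<union> (level n (t + 1) \<union> (level n (t + 2) \<union> (level n (t + 3) \<union> levels_from n (t + 4))))"
      using assms(3) by (simp add: levels_from_unfold eval_nat_numeral)
    then show ?thesis by blast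
  qed
  ultimately show ?thesis by simp
qed

text \<open>Induction on \<open>n - t\<close>, passing from \<open>t\<close> to \<open>t + 4\<close>
  and from \<open>m\<close> to \<open>m + 1\<close>. The inductive claim needs
  \<open>t + 4 < n\<close>; for \<open>n = t + 3\<close> the tail is just 0^n, and
  \<open>n = t + 1\<close>, \<open>t + 2\<close>, \<open>t + 4\<close> are treated directly.\<close>

lemma gray_path_levels_from:
  assumes "0 < m" "t = 4 * m" "t < n"
  shows "gray_path (levels_from n t) (star_at n t 0) (replicate t 0 @ star001 (n - t))"
  using assms
proof (induction "n - t" arbitrary: m t rule: less_induct)
  case less
  note m = less.prems
  \<comment> \<open>The start of the inductive path is rewritten as 0^(t+1) (001)*, the word reached
    by clearing the 1 of \<open>star_at n (t + 1) 0\<close>.\<close>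
  have next_tail: "gray_path (levels_from n (t + 4)) (replicate (t + 1) 0 @ star001 (n - (t + 1))) (replicate (t + 4) 0 @ star001 (n - (t + 4)))"
    if "t + 4 < n"
  proof -
    have "gray_path (levels_from n (t + 4)) (star_at n (t + 4) 0) (replicate (t + 4) 0 @ star001 (n - (t + 4)))"
      using m(2) that by (intro less.hyps[of "t + 4" "Suc m"]) auto
    moreover have "replicate (t + 1) 0 @ star001 (n - (t + 1)) = star_at n (t + 1 + 3) 0"
      using that by (intro zeros_star001_long) simp
    moreover have "t + 1 + 3 = t + 4" by simp
    ultimately show ?thesis by metis
  qed
  have ret_zeros: "adj (replicate n 0) (head_at n (t + 2) 0)" if "t + 3 \<le> n" "n < t + 6"
    using that by (intro adj_sym[OF adj_head_at_all_zeros]) auto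
  consider "n = t + 1" | "n = t + 2" | "n = t + 3" | "n = t + 4" | "n = t + 5" | "t + 6 \<le> n"
    using m(3) by linarith
  then show ?case
  proof cases
    case 1
    have "gray_path ((level n t \<union> level n (t + 1)) \<union> {replicate n 0}) (star_at n t 0) (replicate n 0)"
    proof (rule gray_path_join[OF gray_path_forward gray_path_singleton])
      show "adj (star_at n (t + 1) 0) (replicate n 0)"
        using adj_star_at_zeros[of "t + 1" n] 1 by simp
      show "(level n t \<union> level n (t + 1)) \<inter> {replicate n 0} = {}"
        using ones_zeros[of n] by (auto dest!: level_statistics)
    qed (use m in auto)
    moreover have "levels_from n t = (level n t \<union> level n (t + 1)) \<union> {replicate n 0}"
      using 1 by (simp add: levels_from_unfold levels_from_beyond Un_ac)
    ultimately show ?thesis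
      using zeros_star001_short[of t n] 1 by simp
  next
    case 2
    then show ?thesis
      using gray_path_levels_from_add2[OF m(1,2)] zeros_star001_short[of t n] by simp
  next
    case 3
    have "levels_from n (t + 4) = {replicate n 0}" "replicate (t + 1) 0 @ star001 (n - (t + 1)) = replicate n 0"
      using 3 zeros_star001_short[of "t + 1" n] by (simp_all add: levels_from_beyond)
    then have "gray_path (levels_from n (t + 4)) (replicate (t + 1) 0 @ star001 (n - (t + 1))) (replicate n 0)"
      using gray_path_singleton by simp
    then have "gray_path (levels_from n t) (star_at n t 0) (star_at n (t + 3) 0)"
      using 3 m ret_zeros by (intro gray_path_levels_from_extend[OF m(1,2) _ _ gray_path_return_short[OF m(1,2)]]) auto
    then show ?thesis
      using 3 zeros_star001_long[of t n] by simp
  next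
    case 4
    then show ?thesis
      using gray_path_levels_from_add4[OF m(1,2)] zeros_star001_long[of t n] by simp
  next
    case 5
    \<comment> \<open>Only one letter follows the \<open>t + 4\<close> zeros, so the tail ends at
      0^n and the short return applies.\<close>
    then have "gray_path (levels_from n (t + 4)) (replicate (t + 1) 0 @ star001 (n - (t + 1))) (replicate n 0)"
      using next_tail zeros_star001_short[of "t + 4" n] by simp
    then have "gray_path (levels_from n t) (star_at n t 0) (star_at n (t + 3) 0)"
      using 5 m ret_zeros by (intro gray_path_levels_from_extend[OF m(1,2) _ _ gray_path_return_short[OF m(1,2)]]) auto
    then show ?thesis
      using 5 zeros_star001_long[of t n] by simp
  next
    case 6
    \<comment> \<open>The last word of the tail is 0^(t+3) 0(001)*, one change away from the start
      of the long return.\<close>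
    have "adj (replicate (t + 4) 0 @ star001 (n - (t + 4))) (head_at n (t + 3) 0)"
      using adj_head_at_zeros[of "t + 3" n] zeros_head001[of "t + 3" n] 6 by (auto simp: eval_nat_numeral intro: adj_sym)
    then have "gray_path (levels_from n t) (star_at n t 0) (star_at n (t + 3) 0)"
      using 6 next_tail by (intro gray_path_levels_from_extend[OF m(1,2) _ _ gray_path_return_long[OF m(1,2)]]) auto
    then show ?thesis
      using 6 zeros_star001_long[of t n] by simp
  qed
qed

section \<open>Assembly of the path through \<open>Zset n\<close>\<close>

text \<open>The case \<open>m = 1\<close>: for \<open>n \<ge> 4\<close> the word 0(001)* is
  \<open>star_at n 4 0\<close>, and the final 0^4 (001)* is regrouped as 0^3 followed by
  \<open>head001\<close>. Lengths 3 and 4 fall outside \<open>t < n\<close> and are checked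
  directly.\<close>

lemma gray_path_levels_from_4:
  assumes "3 \<le> n"
  shows "gray_path (levels_from n 4) (head001 n) (replicate 3 0 @ head001 (n - 3))"
proof -
  have head: "head001 n = star_at n 4 0" if "4 \<le> n"
  proof -
    have "head001 n = replicate 1 0 @ star001 (n - 1)"
      using head001_Suc[of "n - 1"] that by simp
    also have "\<dots> = star_at n (1 + 3) 0"
      using that by (intro zeros_star001_long) simp
    finally show ?thesis by simp
  qed
  consider "n = 3" | "n = 4" | "4 < n"
    using assms by linarith
  then show ?thesis
  proof cases
    case 1
    then have "head001 n = replicate n 0"
      using head001_Suc[of 2] by (simp add: eval_nat_numeral)
    then show ?thesis
      using 1 gray_path_singleton by (simp add: levels_from_beyond)
  next
    case 2
    have "rows n = 1" using 2 by (simp add: rows_def)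
    then have "gray_path (level n n) (star_at n n 0) (head_at n n 0)"
      using gray_path_level_star[of n] 2 by simp
    moreover have "adj (head_at n n 0) (replicate n 0)"
      using adj_head_at_zeros[of n n] 2 by simp
    moreover have "level n n \<inter> {replicate n 0} = {}"
      using ones_zeros[of n] by (auto dest!: level_statistics)
    ultimately have "gray_path (level n n \<union> {replicate n 0}) (star_at n n 0) (replicate n 0)"
      using gray_path_join[OF _ gray_path_singleton] by blast
    moreover have "levels_from n n = level n n \<union> {replicate n 0}"
      by (simp add: levels_from_unfold levels_from_beyond)
    moreover have "replicate n 0 = replicate 3 0 @ head001 (n - 3)"
      using 2 head001_Suc[of 0] by (simp add: eval_nat_numeral)
    ultimately show ?thesis
      using head 2 by simp
  next
    case 3
    have "replicate 3 0 @ head001 (n - 3) = replicate 4 0 @ star001 (n - 4)"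
      using zeros_head001[of 3 n] 3 by (simp add: eval_nat_numeral)
    then show ?thesis
      using gray_path_levels_from[of 1 4] 3 head by simp
  qed
qed

text \<open>Level 3 has a single row; entered at its head end, it finishes at 001(001)*, the
  required last word.\<close>

lemma gray_path_Zset_step: "gray_path (Zset n) (head001 n) (star001 n)"
proof (cases "n < 3")
  case True
  \<comment> \<open>Below length 3 the all-zero word is the only element and serves as both
    ends.\<close>
  then have "star001 n = replicate n 0"
    using zeros_star001_short[of 0 n] by simp
  then show ?thesis
    using True gray_path_singleton by (simp add: Zset_eq_levels_from levels_from_beyond head001_eq_star001)
next
  case False
  have "rows 3 = 1" by (simp add: rows_def)
  then have "gray_path (level n 3) (head_at n 3 0) (star_at n 3 0)"
    using gray_path_rev[OF gray_path_level_star[of 3]] False by simp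
  moreover have "gray_path (levels_from n 4) (head001 n) (replicate 3 0 @ head001 (n - 3))"
    using False by (intro gray_path_levels_from_4) simp
  moreover have "adj (replicate 3 0 @ head001 (n - 3)) (head_at n 3 0)"
    by (intro adj_sym[OF adj_head_at_zeros]) simp
  moreover have "levels_from n 4 \<inter> level n 3 = {}"
    by (auto dest!: level_statistics levels_from_statistics)
  ultimately have "gray_path (levels_from n 4 \<union> level n 3) (head001 n) (star_at n 3 0)"
    using gray_path_join by blast
  moreover have "levels_from n 3 = levels_from n 4 \<union> level n 3"
    using levels_from_unfold[of 3 n] False by (auto simp: eval_nat_numeral)
  moreover have "star001 n = star_at n 3 0"
    using zeros_star001_long[of 0 n] False by simp
  ultimately show ?thesis
    by (simp add: Zset_eq_levels_from)
qed

end

lemma gray_path_Zset: "gray_path (Zset n) (head001 n) (star001 n)"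
proof (induction n rule: less_induct)
  case (less n)
  then show ?case by (rule gray_path_Zset_step)
qed

theorem theorem3:
  fixes n :: nat
  shows "\<exists>L. gray_code1 (Zset n) L \<and> L \<noteq> []
           \<and> hd L = take n (0 # star001 n) \<and> last L = star001 n"
proof -
  obtain L where L: "distinct L" "set L = Zset n" "L \<noteq> []" "hd L = head001 n" "last L = star001 n"
    "successively adj L"
    using gray_path_Zset[of n] unfolding gray_path_def by blast
  have "hamming (L ! i) (L ! (i + 1)) \<le> 1" if "i + 1 < length L" for i
    using L(6) that by (intro hamming_adj) (simp add: successively_conv_nth)
  then show ?thesis
    using L by (intro exI[of _ L]) (auto simp: gray_code1_def head001_def)
qed

end
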